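(* Let $k\geq 2$ and $n\geq k+1$ be integers. For a tuple $(s_1,\dots,s_k)$ of positive integers write $S_i=s_1+\cdots+s_i$ for $i=1,\dots,k-1$. Then $$ \sum_{\substack{s_i\geq 1,\ s_1\geq 2\\ s_1+\cdots+s_{k}=n}} \Big[2^{s_1-1}+(2^{s_1-1}-1)\Big(\sum_{i=2}^{k-1} 2^{S_i-s_1-(i-1)}+ 2^{S_{k-1}-s_1-(k-2)}\Big)\Big]\, \zeta(s_1,\dots, s_{k})=n\,\zeta(n), $$ where the inner sum $\sum_{i=2}^{k-1}$ is empty (zero) when $k=2$.
   Context: For integers $s_1\geq 2$ and $s_2,\dots,s_k\geq 1$, the multiple zeta value is $\zeta(s_1,\dots,s_k)=\sum_{n_1>n_2>\cdots>n_k\geq 1} \frac{1}{n_1^{s_1}\cdots n_k^{s_k}}$; for $k=1$ this is the Riemann zeta value $\zeta(n)$. *)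

theory Defs
  imports "HOL-Analysis.Analysis"
begin

definition mzv :: "nat list \<Rightarrow> real" where
  "mzv s = infsum (\<lambda>ns. \<Prod>i<length s. 1 / real (ns ! i) ^ (s ! i))
     {ns. length ns = length s \<and> sorted_wrt (>) ns \<and> (\<forall>m\<in>set ns. m \<ge> 1)}"

definition psum :: "nat list \<Rightarrow> nat \<Rightarrow> nat" where
  "psum s i = sum_list (take i s)"

definition coef :: "nat list \<Rightarrow> real" where
  "coef s = (let k = length s; s1 = s ! 0 in
     2 ^ (s1 - 1) + (2 ^ (s1 - 1) - 1) *
       ((\<Sum>i=2..k-1. 2 ^ (psum s i - s1 - (i - 1))) + 2 ^ (psum s (k-1) - s1 - (k - 2))))"

end

theory Submission
  imports Defs "HOL-Complex_Analysis.Cauchy_Integral_Formula" "HOL-Real_Asymp.Real_Asymp"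
begin

text \<open>
  For fixed depth \<open>k\<close> we compare generating functions in the weight, at a real point \<open>0 < x < 1/2\<close>,
  so that every series has nonnegative terms and summations may be exchanged freely. Summing over
  all exponents turns \<open>1 / n_i ^ s_i\<close> into \<open>1 / (n_i - x)\<close>, and an exponent weighted by a power of 2
  into \<open>1 / (n_i - 2 x)\<close>. Write \<open>e_j(N)\<close> for the sum of \<open>1 / ((n_1 - x) ... (n_j - x))\<close> over
  \<open>N > n_1 > ... > n_j > 0\<close>.

  The weights of the theorem are those of the shuffle product of \<open>\<zeta>(r)\<close> with depth \<open>k - 1\<close> values:
  the generating function of the left-hand side is the sum over \<open>N\<close> of \<open>e_{k-1}(N) / (N (N - x))\<close> plus
  the sum over \<open>a, b > 0\<close> of \<open>e_{k-2}(b) / ((a + b - x) (a - x) (b - x))\<close>. Summing over \<open>a\<close> by partial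
  fractions turns the latter into the sum over \<open>b\<close> of \<open>e_{k-2}(b) e_1(b + 1) / (b (b - x))\<close>.

  Both sums are evaluated by the connected sum method of Seki and Yamamoto. The sums \<open>e_j\<close> arise
  by iterating the operator \<open>(T g)(b) = \<Sum>n>b. g(n) / (n - x)\<close>. The connector
  \<open>c(m,n) = \<Gamma>(m+1-x) \<Gamma>(n+1-x) / (\<Gamma>(1-x) \<Gamma>(m+n+1-x))\<close> is an eigenfunction of \<open>T\<close> in \<open>n\<close> with eigenvalue
  \<open>1/m\<close>, so \<open>d = - \<partial>c/\<partial>m\<close> satisfies \<open>T d = d/m + c/m^2\<close>. It remains to expand \<open>1/n\<close> and \<open>e_1(n + 1) / n\<close>
  into \<open>c(m,n)\<close> and \<open>d(m,n)\<close>, \<open>m > 0\<close>, by telescoping, and to apply powers of \<open>T\<close>.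
\<close>

section \<open>Infinite sums and power series of real numbers\<close>

lemma nonneg_has_sum_SigmaI:
  fixes f :: "'a \<Rightarrow> 'b \<Rightarrow> real"
  assumes "\<And>a b. a \<in> A \<Longrightarrow> b \<in> B a \<Longrightarrow> 0 \<le> f a b"
    and "\<And>a. a \<in> A \<Longrightarrow> (f a has_sum g a) (B a)"
    and "(g has_sum S) A"
  shows "((\<lambda>(a, b). f a b) has_sum S) (Sigma A B)"
proof (rule has_sum_SigmaI)
  show "(\<lambda>(a, b). f a b) summable_on Sigma A B"
    by (rule summable_on_SigmaI[where g = g]) (use assms in \<open>auto intro: has_sum_imp_summable\<close>)
qed (use assms in auto)

lemma nonneg_has_sum_Sigma_swap:
  fixes f :: "'a \<Rightarrow> 'b \<Rightarrow> real"
  assumes domain: "\<And>a b. a \<in> A \<and> b \<in> B a \<longleftrightarrow> b \<in> C \<and> a \<in> D b"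
    and nonneg: "\<And>a b. a \<in> A \<Longrightarrow> b \<in> B a \<Longrightarrow> 0 \<le> f a b"
    and inner: "\<And>a. a \<in> A \<Longrightarrow> (f a has_sum g a) (B a)"
    and outer: "(g has_sum S) A"
  shows "((\<lambda>(b, a). f a b) has_sum S) (Sigma C D)"
proof -
  have "((\<lambda>(a, b). f a b) has_sum S) (Sigma A B)"
    by (rule nonneg_has_sum_SigmaI[OF nonneg inner outer])
  also have "?this \<longleftrightarrow> ?thesis"
    by (rule has_sum_reindex_bij_witness[of _ prod.swap prod.swap]) (use domain in force)+
  finally show ?thesis .
qed

lemma nonneg_has_sum_swap:
  fixes f :: "'a \<Rightarrow> 'b \<Rightarrow> real"
  assumes "\<And>a b. a \<in> A \<and> b \<in> B a \<longleftrightarrow> b \<in> C \<and> a \<in> D b"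
    and "\<And>a b. a \<in> A \<Longrightarrow> b \<in> B a \<Longrightarrow> 0 \<le> f a b"
    and "\<And>a. a \<in> A \<Longrightarrow> (f a has_sum g a) (B a)"
    and "\<And>b. b \<in> C \<Longrightarrow> ((\<lambda>a. f a b) has_sum h b) (D b)"
    and "(g has_sum S) A"
  shows "(h has_sum S) C"
proof (rule has_sum_SigmaD)
  show "((\<lambda>(b, a). f a b) has_sum S) (Sigma C D)"
    by (rule nonneg_has_sum_Sigma_swap[OF assms(1-3,5)])
  show "((\<lambda>a. case (b, a) of (b, a) \<Rightarrow> f a b) has_sum h b) (D b)" if "b \<in> C" for b
    using assms(4)[OF that] by simp
qed

lemma nonneg_has_sum_mult_Times:
  fixes f :: "'a \<Rightarrow> real" and g :: "'b \<Rightarrow> real"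
  assumes "\<And>a. a \<in> A \<Longrightarrow> 0 \<le> f a" "\<And>b. b \<in> B \<Longrightarrow> 0 \<le> g b"
    and "(f has_sum S) A" "(g has_sum T) B"
  shows "((\<lambda>(a, b). f a * g b) has_sum S * T) (A \<times> B)"
  by (rule nonneg_has_sum_SigmaI[where g = "\<lambda>a. f a * T"])
     (use assms in \<open>auto intro!: has_sum_cmult_right has_sum_cmult_left\<close>)

lemma has_sum_sum:
  fixes f :: "'i \<Rightarrow> 'a \<Rightarrow> 'b :: topological_comm_monoid_add"
  assumes "finite I" "\<And>i. i \<in> I \<Longrightarrow> (f i has_sum g i) A"
  shows "((\<lambda>a. \<Sum>i\<in>I. f i a) has_sum (\<Sum>i\<in>I. g i)) A"
  using assms by (induction I rule: finite_induct) (auto intro!: has_sum_add)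

lemma nonneg_has_sum_telescope:
  fixes f u :: "nat \<Rightarrow> real"
  assumes diff: "\<And>n. b \<le> n \<Longrightarrow> f (Suc n) = u n - u (Suc n)"
    and nonneg: "\<And>n. b < n \<Longrightarrow> 0 \<le> f n"
    and lim: "u \<longlonglongrightarrow> 0"
  shows "(f has_sum u b) {b<..}"
proof -
  have "(\<lambda>k. u (k + b) - u (Suc k + b)) sums u b"
    using telescope_sums'[OF LIMSEQ_ignore_initial_segment[OF lim, of b]] by simp
  then have "(\<lambda>k. f (Suc (k + b))) sums u b"
    by (simp add: diff)
  then have "((\<lambda>k. f (Suc (k + b))) has_sum u b) UNIV"
    by (rule sums_nonneg_imp_has_sum) (simp add: nonneg)
  also have "?this \<longleftrightarrow> ?thesis"
    by (rule has_sum_reindex_bij_witness[of _ "\<lambda>n. n - Suc b" "\<lambda>k. Suc (k + b)"]) auto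
  finally show ?thesis .
qed

lemma has_sum_geometric_shifted:
  fixes m y :: real
  assumes "0 \<le> y" "y < m"
  shows "((\<lambda>i. y ^ i / m ^ Suc i) has_sum 1 / (m - y)) UNIV"
proof (rule sums_nonneg_imp_has_sum)
  have "(\<lambda>i. 1 / m * (y / m) ^ i) sums (1 / m * (1 / (1 - y / m)))"
    using assms by (intro sums_mult geometric_sums) auto
  moreover have "1 / m * (1 / (1 - y / m)) = 1 / (m - y)"
    using assms by (simp add: field_simps)
  ultimately show "(\<lambda>i. y ^ i / m ^ Suc i) sums (1 / (m - y))"
    by (simp add: power_divide)
qed (use assms in auto)

lemma has_sum_geometric_deriv_shifted:
  fixes m y :: real
  assumes "0 \<le> y" "y < m"
  shows "((\<lambda>i. real (Suc i) * y ^ i / m ^ (i + 2)) has_sum 1 / (m - y)\<^sup>2) UNIV"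
proof (rule sums_nonneg_imp_has_sum)
  have "(\<lambda>i. 1 / m\<^sup>2 * (real (Suc i) * (y / m) ^ i)) sums (1 / m\<^sup>2 * (1 / (1 - y / m)\<^sup>2))"
    using assms by (intro sums_mult geometric_deriv_sums) auto
  moreover have "1 / m\<^sup>2 * (1 / (1 - y / m)\<^sup>2) = 1 / (m - y)\<^sup>2"
  proof -
    have "m * (1 - y / m) = m - y"
      using assms by (simp add: field_simps)
    then show ?thesis
      by (simp flip: power_mult_distrib)
  qed
  moreover have "1 / m\<^sup>2 * (real (Suc i) * (y / m) ^ i) = real (Suc i) * y ^ i / m ^ (i + 2)" for i
    by (simp add: power_divide power_add power2_eq_square)
  ultimately show "(\<lambda>i. real (Suc i) * y ^ i / m ^ (i + 2)) sums (1 / (m - y)\<^sup>2)"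
    by simp
qed (use assms in auto)

lemma summable_powser_right:
  fixes c :: "nat \<Rightarrow> real"
  assumes "\<And>x. 0 < x \<Longrightarrow> x < r \<Longrightarrow> summable (\<lambda>n. c n * x ^ n)" and "norm x < r"
  shows "summable (\<lambda>n. c n * x ^ n)"
proof -
  obtain y where y: "norm x < y" "y < r"
    using \<open>norm x < r\<close> dense by blast
  then have "0 < y"
    using norm_ge_zero[of x] by linarith
  then have "summable (\<lambda>n. c n * y ^ n)"
    using assms(1) y by simp
  then show ?thesis
    by (rule powser_inside) (use y \<open>0 < y\<close> in auto)
qed

lemma powser_eq_0_right:
  fixes c :: "nat \<Rightarrow> real"
  assumes "0 < r" and sums_0: "\<And>x. 0 < x \<Longrightarrow> x < r \<Longrightarrow> (\<lambda>n. c n * x ^ n) sums 0"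
  shows "c n = 0"
proof (rule ccontr)
  assume "c n \<noteq> 0"
  define f where "f x = (\<Sum>n. c n * x ^ n)" for x
  \<comment> \<open>\<open>powser_0_nonzero\<close> requires a sum that vanishes at 0, which multiplication by \<open>x\<close> ensures.\<close>
  define shifted where "shifted n = (case n of 0 \<Rightarrow> 0 | Suc k \<Rightarrow> c k)" for n
  have shifted_sums: "(\<lambda>n. shifted n * (x - 0) ^ n) sums (x * f x)" if "norm (x - 0) < r" for x
  proof -
    have "summable (\<lambda>n. c n * x ^ n)"
      by (rule summable_powser_right[where r = r]) (use that sums_0 in \<open>auto intro: sums_summable\<close>)
    then have "(\<lambda>n. x * (c n * x ^ n)) sums (x * f x)"
      unfolding f_def by (intro sums_mult summable_sums)
    then have "(\<lambda>n. shifted (Suc n) * x ^ Suc n) sums (x * f x)"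
      by (simp add: shifted_def mult_ac)
    then have "(\<lambda>n. shifted n * x ^ n) sums (x * f x + shifted 0 * x ^ 0)"
      by (rule sums_Suc)
    then show ?thesis
      by (simp add: shifted_def)
  qed
  obtain s where "0 < s" and nonzero: "\<And>z. z \<in> cball 0 s - {0} \<Longrightarrow> z * f z \<noteq> 0"
    by (rule powser_0_nonzero[OF \<open>0 < r\<close> shifted_sums, of "Suc n"])
       (use \<open>c n \<noteq> 0\<close> in \<open>auto simp: shifted_def\<close>)
  define t where "t = min s (r / 2)"
  have "0 < t" "t < r" "t \<le> s"
    using \<open>0 < r\<close> \<open>0 < s\<close> by (auto simp: t_def)
  then show False
    using nonzero[of t] sums_0[of t] by (simp add: f_def sums_iff)
qed

lemma powser_coeffs_eq_right:
  fixes a b :: "nat \<Rightarrow> real"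
  assumes "0 < r"
    and "\<And>x. 0 < x \<Longrightarrow> x < r \<Longrightarrow> \<exists>S. (\<lambda>n. a n * x ^ n) sums S \<and> (\<lambda>n. b n * x ^ n) sums S"
  shows "a n = b n"
proof -
  have "(\<lambda>n. (a n - b n) * x ^ n) sums 0" if x: "0 < x" "x < r" for x
  proof -
    obtain S where "(\<lambda>n. a n * x ^ n) sums S" "(\<lambda>n. b n * x ^ n) sums S"
      using assms(2) x by blast
    from sums_diff[OF this] show ?thesis
      by (simp add: left_diff_distrib)
  qed
  from powser_eq_0_right[OF \<open>0 < r\<close> this] show ?thesis
    by simp
qed

section \<open>Nested sums\<close>

fun nested_sum :: "(nat \<Rightarrow> real) list \<Rightarrow> nat \<Rightarrow> real" where
  "nested_sum [] N = 1"
| "nested_sum (f # fs) N = (\<Sum>m\<in>{1..<N}. f m * nested_sum fs m)"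

lemma nested_sum_nonneg:
  assumes "\<And>f m. f \<in> set fs \<Longrightarrow> 1 \<le> m \<Longrightarrow> 0 \<le> f m"
  shows "0 \<le> nested_sum fs N"
  using assms by (induction fs arbitrary: N) (auto intro!: sum_nonneg mult_nonneg_nonneg)

lemma has_sum_nested_sum_replicate:
  assumes w_nonneg: "\<And>n. 1 \<le> n \<Longrightarrow> 0 \<le> w n" and G_nonneg: "\<And>j n. 1 \<le> n \<Longrightarrow> 0 \<le> G j n"
    and tail: "\<And>j b. ((\<lambda>n. w n * G j n) has_sum G (Suc j) b) {b<..}"
  shows "((\<lambda>n. nested_sum (replicate i w) n * (w n * G j n)) has_sum G (Suc (i + j)) 0) {1..}"
proof (induction i arbitrary: j)
  case 0
  show ?case
    using tail[of j 0] by (simp add: atLeast_Suc_greaterThan)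
next
  case (Suc i)
  let ?term = "\<lambda>m n. nested_sum (replicate i w) m * w m * (w n * G j n)"
  show ?case
  proof (rule nonneg_has_sum_swap[where f = ?term and A = "{1..}" and B = "\<lambda>m. {m<..}"
        and D = "\<lambda>n. {1..<n}"])
    show "(?term m has_sum nested_sum (replicate i w) m * (w m * G (Suc j) m)) {m<..}" for m
      unfolding mult.assoc[symmetric, of _ "w m"] by (intro has_sum_cmult_right tail)
    show "((\<lambda>m. ?term m n) has_sum nested_sum (replicate (Suc i) w) n * (w n * G j n)) {1..<n}" for n
      by (simp add: has_sum_finite_iff sum_distrib_right sum_distrib_left mult_ac)
    show "((\<lambda>m. nested_sum (replicate i w) m * (w m * G (Suc j) m)) has_sum G (Suc (Suc i + j)) 0) {1..}"
      using Suc.IH[of "Suc j"] by simp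
    show "0 \<le> ?term m n" if "m \<in> {1..}" "n \<in> {m<..}" for m n
      using that w_nonneg G_nonneg by (intro mult_nonneg_nonneg nested_sum_nonneg) auto
  qed auto
qed

abbreviation esum :: "nat \<Rightarrow> real \<Rightarrow> nat \<Rightarrow> real" where
  "esum j x \<equiv> nested_sum (replicate j (\<lambda>m. 1 / (real m - x)))"

lemma esum_nonneg: "x < 1 \<Longrightarrow> 0 \<le> esum j x N"
  by (rule nested_sum_nonneg) auto

definition shifted_harm :: "real \<Rightarrow> nat \<Rightarrow> nat \<Rightarrow> real" where
  "shifted_harm x m n = (\<Sum>i=1..n. 1 / (real (m + i) - x))"

lemma shifted_harm_0_left: "shifted_harm x 0 n = esum 1 x (Suc n)"
  by (simp add: shifted_harm_def atLeastLessThanSuc_atLeastAtMost)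

lemma shifted_harm_Suc: "shifted_harm x m (Suc n) = shifted_harm x m n + 1 / (real (m + Suc n) - x)"
  by (simp add: shifted_harm_def)

lemma shifted_harm_diff:
  "shifted_harm x m n - shifted_harm x (Suc m) n = 1 / (real (Suc m) - x) - 1 / (real (Suc m + n) - x)"
  unfolding shifted_harm_def by (induction n) (auto simp: algebra_simps)

lemma shifted_harm_nonneg: "x < 1 \<Longrightarrow> 0 \<le> shifted_harm x m n"
  unfolding shifted_harm_def by (intro sum_nonneg) auto

lemma shifted_harm_tendsto_0: "(\<lambda>m. shifted_harm x m n) \<longlonglongrightarrow> 0"
proof -
  have "(\<lambda>m. 1 / (real (m + i) - x)) \<longlonglongrightarrow> 0" for i
    by real_asymp
  then have "(\<lambda>m. \<Sum>i=1..n. 1 / (real (m + i) - x)) \<longlonglongrightarrow> (\<Sum>i=1..n. 0)"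
    by (intro tendsto_sum)
  then show ?thesis
    by (simp add: shifted_harm_def)
qed

lemma shifted_harm_le_ln:
  assumes "x < 1" "1 \<le> m" "1 \<le> n"
  shows "shifted_harm x m n \<le> 1 + ln (real n)"
proof -
  have "shifted_harm x m n \<le> (\<Sum>i=1..n. 1 / real i)"
    unfolding shifted_harm_def using assms by (intro sum_mono divide_left_mono) auto
  also have "\<dots> = harm n"
    by (simp add: harm_def inverse_eq_divide)
  also have "\<dots> \<le> 1 + ln (real n)"
    using decseqD[OF decseq_harm_diff_ln, of 0 "n - 1"] assms by (simp add: harm_def)
  finally show ?thesis .
qed

section \<open>The connector\<close>

definition connector :: "real \<Rightarrow> nat \<Rightarrow> nat \<Rightarrow> real" where
  "connector x m n = pochhammer (1 - x) m * pochhammer (1 - x) n / pochhammer (1 - x) (m + n)"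

text \<open>Minus the derivative of the connector in \<open>m\<close>, when it is written with Gamma functions.\<close>

definition connector_deriv :: "real \<Rightarrow> nat \<Rightarrow> nat \<Rightarrow> real" where
  "connector_deriv x m n = connector x m n * shifted_harm x m n"

lemma connector_commute: "connector x m n = connector x n m"
  by (simp add: connector_def add.commute)

context
  fixes x :: real
  assumes x_less_1: "x < 1"
begin

lemma connector_pos: "0 < connector x m n"
  using x_less_1 by (simp add: connector_def pochhammer_pos)

lemma connector_deriv_nonneg: "0 \<le> connector_deriv x m n"
  using connector_pos[of m n] shifted_harm_nonneg[OF x_less_1] by (simp add: connector_deriv_def)

lemma connector_0_right: "connector x m 0 = 1"
  using x_less_1 pochhammer_pos[of "1 - x" m] by (simp add: connector_def)

lemma connector_0_left: "connector x 0 n = 1"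
  using connector_0_right[of n] by (simp add: connector_commute[of x 0])

lemma connector_Suc_left:
  "connector x m n = connector x (Suc m) n * ((real (Suc m + n) - x) / (real (Suc m) - x))"
proof -
  have "real (Suc m) - x \<noteq> 0" "real (Suc m + n) - x \<noteq> 0"
    using x_less_1 by auto
  moreover have "pochhammer (1 - x) (Suc k) = pochhammer (1 - x) k * (real (Suc k) - x)" for k
    by (simp add: pochhammer_Suc algebra_simps)
  ultimately show ?thesis
    by (simp add: connector_def)
qed

lemma connector_diff_left:
  "connector x m n - connector x (Suc m) n = real n * (connector x (Suc m) n / (real (Suc m) - x))"
proof -
  have "real (Suc m) - x \<noteq> 0"
    using x_less_1 by auto
  then show ?thesis
    unfolding connector_Suc_left[of m n] by (simp add: field_simps)
qed

lemma connector_diff_right: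
  "connector x m n - connector x m (Suc n) = real m * (connector x m (Suc n) / (real (Suc n) - x))"
  using connector_diff_left[of n m] by (simp only: connector_commute)

lemma connector_le:
  assumes "1 \<le> n"
  shows "connector x m n \<le> (1 - x) / (real (Suc m) - x)"
  using assms
proof (induction n rule: dec_induct)
  case base
  have "real (Suc m) - x > 0" "1 - x > 0"
    using x_less_1 by auto
  then show ?case
    using connector_Suc_left[of 0 m]
    by (simp add: connector_0_left connector_commute[of x m] field_simps)
next
  case (step n)
  have "0 \<le> real m * (connector x m (Suc n) / (real (Suc n) - x))"
    using x_less_1 connector_pos[of m "Suc n"] by auto
  then show ?case
    using step.IH connector_diff_right[of m n] by linarith
qed

lemma connector_tendsto_0:
  assumes "1 \<le> n"
  shows "(\<lambda>m. connector x m n) \<longlonglongrightarrow> 0"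
proof (rule tendsto_sandwich[OF _ _ tendsto_const])
  show "(\<lambda>m. (1 - x) / (real (Suc m) - x)) \<longlonglongrightarrow> 0"
    by real_asymp
qed (use assms connector_le connector_pos[THEN less_imp_le] in auto)

lemma connector_deriv_tendsto_0_left:
  assumes "1 \<le> n"
  shows "(\<lambda>m. connector_deriv x m n) \<longlonglongrightarrow> 0"
  unfolding connector_deriv_def
  by (intro tendsto_mult_zero connector_tendsto_0 shifted_harm_tendsto_0 assms)

lemma connector_deriv_tendsto_0_right:
  assumes "1 \<le> m"
  shows "(\<lambda>n. connector_deriv x m n) \<longlonglongrightarrow> 0"
proof (rule tendsto_sandwich[OF _ _ tendsto_const])
  show "\<forall>\<^sub>F n in sequentially. 0 \<le> connector_deriv x m n"
    by (simp add: connector_deriv_nonneg)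
  show "(\<lambda>n. (1 - x) / (real (Suc n) - x) * (1 + ln (real n))) \<longlonglongrightarrow> 0"
    by real_asymp
  have "connector_deriv x m n \<le> (1 - x) / (real (Suc n) - x) * (1 + ln (real n))" if "1 \<le> n" for n
    unfolding connector_deriv_def
  proof (rule mult_mono)
    show "connector x m n \<le> (1 - x) / (real (Suc n) - x)"
      using connector_le[OF assms, of n] by (simp add: connector_commute)
    show "shifted_harm x m n \<le> 1 + ln (real n)"
      by (rule shifted_harm_le_ln[OF x_less_1 assms that])
  qed (use x_less_1 shifted_harm_nonneg in auto)
  then show "\<forall>\<^sub>F n in sequentially.
      connector_deriv x m n \<le> (1 - x) / (real (Suc n) - x) * (1 + ln (real n))"
    by (auto intro: eventually_sequentiallyI)
qed

lemma connector_deriv_diff_left: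
  "connector_deriv x m n - connector_deriv x (Suc m) n =
     real n * (connector_deriv x (Suc m) n / (real (Suc m) - x)
       + connector x (Suc m) n / (real (Suc m) - x)\<^sup>2)"
proof -
  define c h u v where "c = connector x (Suc m) n"
    and "h = shifted_harm x (Suc m) n"
    and "u = real (Suc m) - x" and "v = real (Suc m + n) - x"
  have "u > 0" "v > 0" and v: "v = u + real n"
    using x_less_1 by (auto simp: u_def v_def)
  have "shifted_harm x m n = h + 1 / u - 1 / v"
    using shifted_harm_diff[of x m n] by (simp add: h_def u_def v_def)
  then have "connector_deriv x m n - connector_deriv x (Suc m) n =
      c * (v / u) * (h + 1 / u - 1 / v) - c * h"
    unfolding connector_deriv_def connector_Suc_left[of m n] c_def h_def u_def v_def by simp
  also have "\<dots> = real n * (c * h / u + c / u\<^sup>2)"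
    using \<open>u > 0\<close> \<open>v > 0\<close> by (simp add: field_simps power2_eq_square) (simp add: v algebra_simps)
  finally show ?thesis
    by (simp add: connector_deriv_def c_def h_def u_def)
qed

lemma connector_deriv_diff_right:
  "connector_deriv x m n - connector_deriv x m (Suc n) =
     (real m * connector_deriv x m (Suc n) - connector x m (Suc n)) / (real (Suc n) - x)"
proof -
  define c h u v where "c = connector x m (Suc n)"
    and "h = shifted_harm x m n"
    and "u = real (Suc n) - x" and "v = real (m + Suc n) - x"
  have "u > 0" "v > 0" and v: "v = u + real m"
    using x_less_1 by (auto simp: u_def v_def)
  have "connector x m n = c * (v / u)"
    using connector_Suc_left[of n m] by (simp add: c_def u_def v_def connector_commute add.commute)
  then have "connector_deriv x m n - connector_deriv x m (Suc n) = c * (v / u) * h - c * (h + 1 / v)"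
    by (simp add: connector_deriv_def shifted_harm_Suc c_def h_def v_def)
  also have "\<dots> = (real m * (c * (h + 1 / v)) - c) / u"
    using \<open>u > 0\<close> \<open>v > 0\<close> by (simp add: field_simps) (simp add: v algebra_simps)
  finally show ?thesis
    by (simp add: connector_deriv_def shifted_harm_Suc c_def h_def u_def v_def)
qed

lemma has_sum_connector_right:
  assumes "1 \<le> m"
  shows "((\<lambda>n. 1 / (real n - x) * connector x m n) has_sum connector x m b / real m) {b<..}"
proof (rule nonneg_has_sum_telescope)
  show "(\<lambda>n. connector x m n / real m) \<longlonglongrightarrow> 0"
    using tendsto_divide[OF connector_tendsto_0[OF assms] tendsto_const[of "real m"]] assms
    by (simp add: connector_commute[of x m])
  show "1 / (real (Suc n) - x) * connector x m (Suc n) =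
      connector x m n / real m - connector x m (Suc n) / real m" for n
    using connector_diff_right[of m n] assms by (simp flip: diff_divide_distrib)
  show "0 \<le> 1 / (real n - x) * connector x m n" if "b < n" for n
    using that x_less_1 connector_pos[of m n] by auto
qed

lemma has_sum_connector_left:
  assumes "1 \<le> n"
  shows "((\<lambda>m. connector x m n / (real m - x)) has_sum 1 / real n) {1..}"
  using has_sum_connector_right[OF assms, of 0]
  by (simp add: connector_commute[of x n] connector_0_left atLeast_Suc_greaterThan)

lemma has_sum_connector_deriv_right:
  assumes "1 \<le> m"
  shows "((\<lambda>n. 1 / (real n - x) * connector_deriv x m n) has_sum
            connector_deriv x m b / real m + connector x m b / (real m)\<^sup>2) {b<..}"
proof (rule nonneg_has_sum_telescope)
  have "(\<lambda>n. connector_deriv x m n / real m + connector x n m / (real m)\<^sup>2)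
      \<longlonglongrightarrow> 0 / real m + 0 / (real m)\<^sup>2"
    using assms by (intro tendsto_intros connector_deriv_tendsto_0_right connector_tendsto_0) auto
  then show "(\<lambda>n. connector_deriv x m n / real m + connector x m n / (real m)\<^sup>2) \<longlonglongrightarrow> 0"
    by (simp add: connector_commute[of x m])
  show "1 / (real (Suc n) - x) * connector_deriv x m (Suc n) =
      connector_deriv x m n / real m + connector x m n / (real m)\<^sup>2
        - (connector_deriv x m (Suc n) / real m + connector x m (Suc n) / (real m)\<^sup>2)" for n
  proof -
    define c d u where "c = connector x m (Suc n)" and "d = connector_deriv x m (Suc n)"
      and "u = real (Suc n) - x"
    have "connector_deriv x m n / real m + connector x m n / (real m)\<^sup>2 - (d / real m + c / (real m)\<^sup>2) =
        (connector_deriv x m n - d) / real m + (connector x m n - c) / (real m)\<^sup>2"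
      by (simp add: diff_divide_distrib)
    also have "\<dots> = (real m * d - c) / u / real m + real m * (c / u) / (real m)\<^sup>2"
      by (simp only: connector_diff_right connector_deriv_diff_right c_def d_def u_def)
    also have "\<dots> = 1 / u * d"
      using assms x_less_1 by (simp add: u_def diff_divide_distrib power2_eq_square mult_ac)
    finally show ?thesis
      by (simp add: c_def d_def u_def)
  qed
  show "0 \<le> 1 / (real n - x) * connector_deriv x m n" if "b < n" for n
    using that x_less_1 connector_deriv_nonneg[of m n] by auto
qed

lemma has_sum_connector_deriv_left:
  assumes "1 \<le> n"
  shows "((\<lambda>m. connector_deriv x m n / (real m - x) + connector x m n / (real m - x)\<^sup>2) has_sum
            esum 1 x (Suc n) / real n) {1..}"
proof -
  have "((\<lambda>m. connector_deriv x m n / (real m - x) + connector x m n / (real m - x)\<^sup>2) has_sum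
            connector_deriv x 0 n / real n) {0<..}"
  proof (rule nonneg_has_sum_telescope)
    show "(\<lambda>m. connector_deriv x m n / real n) \<longlonglongrightarrow> 0"
      using tendsto_divide[OF connector_deriv_tendsto_0_left[OF assms] tendsto_const[of "real n"]] assms
      by simp
    show "connector_deriv x (Suc m) n / (real (Suc m) - x)
          + connector x (Suc m) n / (real (Suc m) - x)\<^sup>2 =
        connector_deriv x m n / real n - connector_deriv x (Suc m) n / real n" for m
      using connector_deriv_diff_left[of m n] assms by (simp flip: diff_divide_distrib)
    show "0 \<le> connector_deriv x m n / (real m - x) + connector x m n / (real m - x)\<^sup>2" if "0 < m" for m
      using that x_less_1 connector_pos[of m n] connector_deriv_nonneg[of m n] by auto
  qed
  moreover have "connector_deriv x 0 n = esum 1 x (Suc n)"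
    by (simp only: connector_deriv_def connector_0_left shifted_harm_0_left mult_1)
  ultimately show ?thesis
    by (simp add: atLeast_Suc_greaterThan)
qed

section \<open>The sum formula\<close>

lemma has_sum_esum_connector:
  assumes "1 \<le> m"
  shows "((\<lambda>n. esum j x n * (1 / (real n - x) * connector x m n)) has_sum 1 / real m ^ Suc j) {1..}"
proof -
  have "((\<lambda>n. 1 / (real n - x) * (connector x m n / real m ^ i)) has_sum
      connector x m b / real m ^ Suc i) {b<..}" for i b
    using has_sum_divide_const[OF has_sum_connector_right[OF assms, of b], of "real m ^ i"] by simp
  from has_sum_nested_sum_replicate[where G = "\<lambda>i b. connector x m b / real m ^ i", OF _ _ this, of j 0]
  show ?thesis
    using x_less_1 connector_pos[of m] by (simp add: connector_0_right less_imp_le)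
qed

lemma has_sum_esum_connector_deriv:
  assumes "1 \<le> m"
  shows "((\<lambda>n. esum j x n * (1 / (real n - x) * connector_deriv x m n)) has_sum
            real (Suc j) / real m ^ (j + 2)) {1..}"
proof -
  let ?G = "\<lambda>i b. connector_deriv x m b / real m ^ i + real i * (connector x m b / real m ^ Suc i)"
  have "((\<lambda>n. 1 / (real n - x) * ?G i n) has_sum ?G (Suc i) b) {b<..}" for i b
  proof -
    have "((\<lambda>n. 1 / (real n - x) * connector_deriv x m n / real m ^ i
          + real i * (1 / (real n - x) * connector x m n / real m ^ Suc i)) has_sum
        (connector_deriv x m b / real m + connector x m b / (real m)\<^sup>2) / real m ^ i
          + real i * (connector x m b / real m / real m ^ Suc i)) {b<..}"
      by (intro has_sum_add has_sum_divide_const has_sum_cmult_right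
          has_sum_connector_right has_sum_connector_deriv_right assms)
    then show ?thesis
      by (simp add: distrib_left distrib_right add_divide_distrib power2_eq_square mult_ac add_ac)
  qed
  from has_sum_nested_sum_replicate[where G = ?G, OF _ _ this, of j 0] show ?thesis
    using x_less_1 connector_pos[of m] connector_deriv_nonneg[of m]
    by (simp add: connector_deriv_def[of x m 0] shifted_harm_def connector_0_right less_imp_le)
qed

lemma sum_formula:
  assumes "((\<lambda>m. 1 / (real m ^ Suc j * (real m - x))) has_sum S) {1..}"
  shows "((\<lambda>n. esum j x n / (real n * (real n - x))) has_sum S) {1..}"
proof (rule nonneg_has_sum_swap[OF _ _ _ _ assms])
  let ?term = "\<lambda>m n. esum j x n * (1 / (real n - x) * connector x m n) / (real m - x)"
  show "(?term m has_sum 1 / (real m ^ Suc j * (real m - x))) {1..}" if "m \<in> {1..}" for m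
    using has_sum_divide_const[OF has_sum_esum_connector, of m j "real m - x"] that by simp
  show "((\<lambda>m. ?term m n) has_sum esum j x n / (real n * (real n - x))) {1..}" if "n \<in> {1..}" for n
    using has_sum_cmult_right[OF has_sum_connector_left, of n "esum j x n / (real n - x)"] that
    by (simp add: mult_ac)
  show "0 \<le> ?term m n" if "m \<in> {1..}" "n \<in> {1..}" for m n
    using that x_less_1 esum_nonneg[OF x_less_1, of j n] connector_pos[of m n] by auto
qed auto

lemma sum_formula_esum_1:
  assumes "((\<lambda>m. real (Suc j) / (real m ^ (j + 2) * (real m - x))
      + 1 / (real m ^ Suc j * (real m - x)\<^sup>2)) has_sum S) {1..}"
  shows "((\<lambda>n. esum j x n * esum 1 x (Suc n) / (real n * (real n - x))) has_sum S) {1..}"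
proof (rule nonneg_has_sum_swap[OF _ _ _ _ assms])
  let ?term = "\<lambda>m n. esum j x n * (1 / (real n - x) * connector_deriv x m n) / (real m - x)
    + esum j x n * (1 / (real n - x) * connector x m n) / (real m - x)\<^sup>2"
  show "(?term m has_sum real (Suc j) / (real m ^ (j + 2) * (real m - x))
      + 1 / (real m ^ Suc j * (real m - x)\<^sup>2)) {1..}" if "m \<in> {1..}" for m
    unfolding divide_divide_eq_left[symmetric] using that
    by (intro has_sum_add has_sum_divide_const has_sum_esum_connector has_sum_esum_connector_deriv) auto
  show "((\<lambda>m. ?term m n) has_sum esum j x n * esum 1 x (Suc n) / (real n * (real n - x))) {1..}"
    if "n \<in> {1..}" for n
    using has_sum_cmult_right[OF has_sum_connector_deriv_left, of n "esum j x n / (real n - x)"] that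
    by (simp add: distrib_left mult_ac del: nested_sum.simps)
  show "0 \<le> ?term m n" if "m \<in> {1..}" "n \<in> {1..}" for m n
    using that x_less_1 esum_nonneg[OF x_less_1, of j n] connector_pos[of m n]
      connector_deriv_nonneg[of m n] by auto
qed auto

end

section \<open>The shuffle product\<close>

text \<open>The generating function, in the weight, of the coefficient of \<open>t ^ N\<close> in the product of a single
  polylogarithm with a multiple polylogarithm of depth \<open>j + 1\<close> in \<open>t\<close>.\<close>

definition shuffle_sum :: "nat \<Rightarrow> real \<Rightarrow> nat \<Rightarrow> real" where
  "shuffle_sum j x N = (\<Sum>b\<in>{1..<N}. esum j x b / ((real (N - b) - x) * (real b - x)))"

context
  fixes x :: real
  assumes x_less_1: "x < 1"
begin

lemma shuffle_sum_partial_fractions: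
  "(real N - 2 * x) * shuffle_sum j x N =
     esum (Suc j) x N + (\<Sum>b\<in>{1..<N}. esum j x b / (real (N - b) - x))"
proof -
  have "(real N - 2 * x) * (esum j x b / ((real (N - b) - x) * (real b - x))) =
      esum j x b / (real b - x) + esum j x b / (real (N - b) - x)" if "b \<in> {1..<N}" for b
  proof -
    define u v where "u = real (N - b) - x" and "v = real b - x"
    have "u \<noteq> 0" "v \<noteq> 0" and "real N - 2 * x = u + v"
      using that x_less_1 by (auto simp: u_def v_def of_nat_diff)
    then have "(real N - 2 * x) * (esum j x b / (u * v)) = esum j x b / v + esum j x b / u"
      by (simp add: field_simps)
    then show ?thesis
      by (simp only: u_def v_def)
  qed
  then show ?thesis
    by (simp add: shuffle_sum_def sum_distrib_left sum.distrib)
qed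

lemma shuffle_sum_0: "(real N - 2 * x) * shuffle_sum 0 x N = 2 * esum 1 x N"
proof -
  have "(\<Sum>b\<in>{1..<N}. 1 / (real (N - b) - x)) = (\<Sum>b\<in>{1..<N}. 1 / (real b - x))"
    by (rule sum.reindex_bij_witness[of _ "\<lambda>b. N - b" "\<lambda>b. N - b"]) auto
  then show ?thesis
    by (simp add: shuffle_sum_partial_fractions)
qed

lemma sum_shuffle_sum:
  "(\<Sum>m\<in>{1..<N}. shuffle_sum j x m) = (\<Sum>b\<in>{1..<N}. esum (Suc j) x b / (real (N - b) - x))"
proof -
  have "(\<Sum>m\<in>{1..<N}. shuffle_sum j x m) =
      (\<Sum>(m, c)\<in>Sigma {1..<N} (\<lambda>m. {1..<m}). esum j x c / ((real (m - c) - x) * (real c - x)))"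
    unfolding shuffle_sum_def by (rule sum.Sigma) auto
  also have "\<dots> = (\<Sum>(b, c)\<in>Sigma {1..<N} (\<lambda>b. {1..<b}). esum j x c / ((real (N - b) - x) * (real c - x)))"
    by (rule sum.reindex_bij_witness[of _ "\<lambda>(b, c). (N - b + c, c)" "\<lambda>(m, c). (N - (m - c), c)"]) auto
  also have "\<dots> = (\<Sum>b\<in>{1..<N}. \<Sum>c\<in>{1..<b}. esum j x c / ((real (N - b) - x) * (real c - x)))"
    by (rule sum.Sigma[symmetric]) auto
  also have "\<dots> = (\<Sum>b\<in>{1..<N}. esum (Suc j) x b / (real (N - b) - x))"
    by (simp add: sum_divide_distrib mult.commute)
  finally show ?thesis .
qed

lemma shuffle_sum_Suc:
  "(real N - 2 * x) * shuffle_sum (Suc j) x N = esum (j + 2) x N + (\<Sum>m\<in>{1..<N}. shuffle_sum j x m)"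
  unfolding sum_shuffle_sum shuffle_sum_partial_fractions by simp

lemma has_sum_inverse_shifted_mult:
  assumes "1 \<le> b"
  shows "((\<lambda>N. 1 / ((real N - x) * (real (N - b) - x))) has_sum esum 1 x (Suc b) / real b) {b<..}"
proof -
  have "((\<lambda>a. 1 / ((real (a + b) - x) * (real a - x))) has_sum shifted_harm x 0 b / real b) {0<..}"
  proof (rule nonneg_has_sum_telescope)
    show "(\<lambda>a. shifted_harm x a b / real b) \<longlonglongrightarrow> 0"
      by (intro tendsto_divide_zero shifted_harm_tendsto_0)
    show "1 / ((real (Suc a + b) - x) * (real (Suc a) - x)) =
        shifted_harm x a b / real b - shifted_harm x (Suc a) b / real b" for a
    proof -
      define u v where "u = real (Suc a) - x" and "v = real (Suc a + b) - x"
      have "u \<noteq> 0" "v \<noteq> 0" and v: "v = u + real b"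
        using x_less_1 by (auto simp: u_def v_def)
      have "shifted_harm x a b - shifted_harm x (Suc a) b = 1 / u - 1 / v"
        by (simp only: shifted_harm_diff u_def v_def)
      also have "\<dots> = real b / (v * u)"
        using \<open>u \<noteq> 0\<close> \<open>v \<noteq> 0\<close> by (simp add: field_simps) (simp add: v)
      finally have "shifted_harm x a b / real b - shifted_harm x (Suc a) b / real b = 1 / (v * u)"
        using assms by (simp flip: diff_divide_distrib)
      then show ?thesis
        by (simp only: u_def v_def)
    qed
    show "0 \<le> 1 / ((real (a + b) - x) * (real a - x))" if "0 < a" for a
      using that x_less_1 by auto
  qed
  also have "?this \<longleftrightarrow>
      ((\<lambda>N. 1 / ((real N - x) * (real (N - b) - x))) has_sum shifted_harm x 0 b / real b) {b<..}"
    by (rule has_sum_reindex_bij_witness[of _ "\<lambda>N. N - b" "\<lambda>a. a + b"]) auto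
  finally show ?thesis
    by (simp only: shifted_harm_0_left)
qed

lemma has_sum_shuffle_sum:
  assumes "((\<lambda>b. esum j x b * esum 1 x (Suc b) / (real b * (real b - x))) has_sum S) {1..}"
  shows "((\<lambda>N. shuffle_sum j x N / (real N - x)) has_sum S) {1..}"
proof (rule nonneg_has_sum_swap[where A = "{1..}" and B = "\<lambda>b. {b<..}" and D = "\<lambda>N. {1..<N}",
      OF _ _ _ _ assms])
  let ?term = "\<lambda>b N. esum j x b / (real b - x) * (1 / ((real N - x) * (real (N - b) - x)))"
  show "(?term b has_sum esum j x b * esum 1 x (Suc b) / (real b * (real b - x))) {b<..}"
    if "b \<in> {1..}" for b
    using has_sum_cmult_right[OF has_sum_inverse_shifted_mult, of b "esum j x b / (real b - x)"] that
    by (simp add: mult_ac del: nested_sum.simps)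
  show "((\<lambda>b. ?term b N) has_sum shuffle_sum j x N / (real N - x)) {1..<N}" for N
    by (simp add: has_sum_finite_iff shuffle_sum_def sum_divide_distrib mult_ac)
  show "0 \<le> ?term b N" if "b \<in> {1..}" "N \<in> {b<..}" for b N
    using that x_less_1 esum_nonneg[OF x_less_1, of j b] by auto
qed auto

end

lemma summable_on_inverse_shifted_powers:
  fixes x :: real
  assumes "0 \<le> x" "x < 1" "2 \<le> i + j"
  shows "(\<lambda>m. 1 / (real m ^ i * (real m - x) ^ j)) summable_on {1..}"
proof (rule summable_on_comparison_test)
  have "(\<lambda>n. 1 / real (Suc n) ^ 2) summable_on UNIV"
    using inverse_power_summable[of 2, where 'a = real]
    by (intro summable_nonneg_imp_summable_on) (subst summable_Suc_iff, auto simp: inverse_eq_divide)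
  also have "?this \<longleftrightarrow> (\<lambda>m. 1 / real m ^ 2) summable_on {1..}"
    by (rule summable_on_reindex_bij_witness[of _ "\<lambda>m. m - 1" Suc]) auto
  finally show "(\<lambda>m. (1 / (1 - x)) ^ j * (1 / real m ^ 2)) summable_on {1..}"
    by (rule summable_on_cmult_right)
next
  fix m :: nat assume "m \<in> {1..}"
  then have "1 \<le> real m"
    by simp
  have "x * 1 \<le> x * real m"
    using assms \<open>1 \<le> real m\<close> by (intro mult_left_mono)
  then have shift: "(1 - x) * real m \<le> real m - x"
    by (simp add: algebra_simps)
  have "(1 - x) ^ j * real m ^ 2 \<le> (1 - x) ^ j * real m ^ (i + j)"
    using assms \<open>1 \<le> real m\<close> by (intro mult_left_mono power_increasing) auto
  also have "\<dots> = real m ^ i * ((1 - x) * real m) ^ j"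
    by (simp add: power_add power_mult_distrib)
  also have "\<dots> \<le> real m ^ i * (real m - x) ^ j"
    using shift assms by (intro mult_left_mono power_mono) auto
  finally show "1 / (real m ^ i * (real m - x) ^ j) \<le> (1 / (1 - x)) ^ j * (1 / real m ^ 2)"
    using assms \<open>1 \<le> real m\<close> by (simp add: power_one_over frac_le)
  show "0 \<le> 1 / (real m ^ i * (real m - x) ^ j)"
    using assms \<open>1 \<le> real m\<close> by simp
qed

section \<open>Generating functions of multiple zeta values\<close>

abbreviation truncated_mzv :: "nat list \<Rightarrow> nat \<Rightarrow> real" where
  "truncated_mzv s \<equiv> nested_sum (map (\<lambda>a m. 1 / real m ^ a) s)"

abbreviation mzv_term :: "nat list \<Rightarrow> nat list \<Rightarrow> real" where
  "mzv_term s ns \<equiv> \<Prod>i<length s. 1 / real (ns ! i) ^ (s ! i)"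

definition decreasing_lists :: "nat \<Rightarrow> nat \<Rightarrow> nat list set" where
  "decreasing_lists l N = {ns. length ns = l \<and> sorted_wrt (>) ns \<and> (\<forall>m\<in>set ns. 1 \<le> m \<and> m < N)}"

lemma truncated_mzv_nonneg: "0 \<le> truncated_mzv s N"
  by (rule nested_sum_nonneg) auto

lemma has_sum_mzv_term_Cons:
  assumes inner: "\<And>m. m \<in> A \<Longrightarrow> (mzv_term s has_sum truncated_mzv s m) (decreasing_lists (length s) m)"
    and outer: "((\<lambda>m. truncated_mzv s m / real m ^ a) has_sum v) A"
  shows "(mzv_term (a # s) has_sum v) {m # ns |m ns. m \<in> A \<and> ns \<in> decreasing_lists (length s) m}"
proof -
  have "((\<lambda>(m, ns). mzv_term s ns / real m ^ a) has_sum v) (Sigma A (decreasing_lists (length s)))"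
    using inner
    by (intro nonneg_has_sum_SigmaI[OF _ _ outer] has_sum_divide_const divide_nonneg_nonneg prod_nonneg)
       auto
  also have "?this \<longleftrightarrow> ?thesis"
    by (rule has_sum_reindex_bij_witness[of _ "\<lambda>ns. (hd ns, tl ns)" "\<lambda>(m, ns). m # ns"])
       (auto simp: prod.lessThan_Suc_shift simp del: prod.lessThan_Suc)
  finally show ?thesis .
qed

lemma has_sum_mzv_term_truncated:
  "(mzv_term s has_sum truncated_mzv s N) (decreasing_lists (length s) N)"
proof (induction s arbitrary: N)
  case Nil
  have "decreasing_lists 0 N = {[]}"
    by (auto simp: decreasing_lists_def)
  then show ?case
    by (simp add: has_sum_finite_iff)
next
  case (Cons a s)
  have "decreasing_lists (length (a # s)) N =
      {m # ns |m ns. m \<in> {1..<N} \<and> ns \<in> decreasing_lists (length s) m}"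
    by (fastforce simp: decreasing_lists_def length_Suc_conv intro: less_trans)
  moreover have "((\<lambda>m. truncated_mzv s m / real m ^ a) has_sum truncated_mzv (a # s) N) {1..<N}"
    by (simp add: has_sum_finite_iff)
  ultimately show ?case
    using has_sum_mzv_term_Cons[where A = "{1..<N}", OF Cons.IH] by (simp only:)
qed

lemma mzv_Cons_eqI:
  assumes "((\<lambda>m. truncated_mzv s m / real m ^ a) has_sum v) {1..}"
  shows "mzv (a # s) = v"
proof -
  have "{ns. length ns = length (a # s) \<and> sorted_wrt (>) ns \<and> (\<forall>m\<in>set ns. m \<ge> 1)} =
      {m # ns |m ns. m \<in> {1..} \<and> ns \<in> decreasing_lists (length s) m}"
    by (auto simp: decreasing_lists_def length_Suc_conv)
  then show ?thesis
    unfolding mzv_def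
    using infsumI[OF has_sum_mzv_term_Cons[OF has_sum_mzv_term_truncated assms]] by simp
qed

lemma nonneg_has_sum_mzv_Cons:
  fixes w :: "'i \<Rightarrow> real"
  assumes w_pos: "\<And>i. i \<in> I \<Longrightarrow> 0 < w i"
    and terms: "\<And>N. 1 \<le> N \<Longrightarrow> ((\<lambda>i. w i * (truncated_mzv (s i) N / real N ^ a i)) has_sum g N) I"
    and outer: "(g has_sum S) {1..}"
  shows "((\<lambda>i. w i * mzv (a i # s i)) has_sum S) I"
proof -
  have swapped: "((\<lambda>(i, N). w i * (truncated_mzv (s i) N / real N ^ a i)) has_sum S) (I \<times> {1..})"
    by (rule nonneg_has_sum_Sigma_swap[OF _ _ _ outer])
       (use terms w_pos truncated_mzv_nonneg in \<open>auto simp: less_imp_le\<close>)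
  show ?thesis
  proof (rule has_sum_SigmaD[OF swapped], unfold prod.case, rule has_sum_cmult_right)
    fix i assume "i \<in> I"
    then have "(\<lambda>N. w i * (truncated_mzv (s i) N / real N ^ a i)) summable_on {1..}"
      using summable_on_SigmaD1[OF has_sum_imp_summable[OF swapped]] by simp
    then have "(\<lambda>N. truncated_mzv (s i) N / real N ^ a i) summable_on {1..}"
      using w_pos[OF \<open>i \<in> I\<close>] by (subst (asm) summable_on_cmult_right') auto
    then show "((\<lambda>N. truncated_mzv (s i) N / real N ^ a i) has_sum mzv (a i # s i)) {1..}"
      using mzv_Cons_eqI[OF has_sum_infsum] by simp
  qed
qed

text \<open>Exponents are written as \<open>map Suc u\<close>, so that sums over compositions become sums over all lists
  \<open>u\<close> of a given length.\<close>

lemma has_sum_truncated_mzv_Cons: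
  fixes y :: real
  assumes y: "0 \<le> y" "y < 1" and g_nonneg: "\<And>u. 0 \<le> g u"
    and tail: "\<And>m. ((\<lambda>u. g u * truncated_mzv (map Suc u) m) has_sum G m) {u. length u = l}"
  shows "((\<lambda>u. y ^ hd u * g (tl u) * truncated_mzv (map Suc u) N) has_sum
            (\<Sum>m\<in>{1..<N}. G m / (real m - y))) {u. length u = Suc l}"
proof -
  have "((\<lambda>(i, u). y ^ i / real m ^ Suc i * (g u * truncated_mzv (map Suc u) m)) has_sum
      1 / (real m - y) * G m) (UNIV \<times> {u. length u = l})" if "m \<in> {1..<N}" for m
    using that y
    by (intro nonneg_has_sum_mult_Times has_sum_geometric_shifted tail mult_nonneg_nonneg g_nonneg
        truncated_mzv_nonneg) auto
  then have "((\<lambda>iu. \<Sum>m\<in>{1..<N}. case iu of (i, u) \<Rightarrow>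
        y ^ i / real m ^ Suc i * (g u * truncated_mzv (map Suc u) m)) has_sum
      (\<Sum>m\<in>{1..<N}. 1 / (real m - y) * G m)) (UNIV \<times> {u. length u = l})"
    by (intro has_sum_sum) auto
  also have "?this \<longleftrightarrow> ?thesis"
    by (rule has_sum_reindex_bij_witness[of _ "\<lambda>u. (hd u, tl u)" "\<lambda>(i, u). i # u"])
       (auto simp: length_Suc_conv sum_distrib_left mult_ac)
  finally show ?thesis .
qed

lemma has_sum_power_truncated_mzv:
  assumes "0 \<le> x" "x < 1"
  shows "((\<lambda>u. x ^ sum_list u * truncated_mzv (map Suc u) N) has_sum esum l x N) {u. length u = l}"
proof (induction l arbitrary: N)
  case 0
  show ?case
    by (simp add: has_sum_finite_iff)
next
  case (Suc l)
  have "((\<lambda>u. x ^ hd u * x ^ sum_list (tl u) * truncated_mzv (map Suc u) N) has_sum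
      (\<Sum>m\<in>{1..<N}. esum l x m / (real m - x))) {u. length u = Suc l}"
    using assms by (intro has_sum_truncated_mzv_Cons Suc.IH) auto
  also have "(\<Sum>m\<in>{1..<N}. esum l x m / (real m - x)) = esum (Suc l) x N"
    by simp
  also have "((\<lambda>u. x ^ hd u * x ^ sum_list (tl u) * truncated_mzv (map Suc u) N) has_sum
      esum (Suc l) x N) {u. length u = Suc l} \<longleftrightarrow> ?case"
    by (rule has_sum_cong) (auto simp: length_Suc_conv power_add)
  finally show ?case .
qed

definition tail_coef :: "nat list \<Rightarrow> real" where
  "tail_coef u = (\<Sum>j<length u. 2 ^ sum_list (take j u)) + 2 ^ sum_list (butlast u)"

lemma tail_coef_nonneg: "0 \<le> tail_coef u"
  by (simp add: tail_coef_def sum_nonneg)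

lemma tail_coef_singleton: "tail_coef [i] = 2"
  by (simp add: tail_coef_def)

lemma tail_coef_Cons:
  assumes "u \<noteq> []"
  shows "tail_coef (i # u) = 1 + 2 ^ i * tail_coef u"
  using assms unfolding tail_coef_def list.size add_Suc_right add_0_right sum.lessThan_Suc_shift
  by (simp add: power_add sum_distrib_left distrib_left)

lemma coef_eq_tail_coef:
  assumes "u \<noteq> []"
  shows "coef ((i + 2) # map Suc u) = 1 + (2 ^ Suc i - 1) * tail_coef u"
proof -
  define s where "s = (i + 2) # map Suc u"
  define q :: "nat \<Rightarrow> real" where "q j = 2 ^ sum_list (take j u)" for j
  obtain l where l: "length u = Suc l"
    using assms by (cases u) auto
  have q: "2 ^ (psum s j - (i + 2) - (j - 1)) = q (j - 1)" if "j \<in> {1..Suc (Suc l)}" for j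
    using that l by (cases j) (auto simp: psum_def s_def q_def take_map sum_list_Suc)
  have "(\<Sum>j=2..Suc l. 2 ^ (psum s j - (i + 2) - (j - 1))) = (\<Sum>j=2..Suc l. q (j - 1))"
    by (intro sum.cong q) auto
  also have "\<dots> = (\<Sum>j=1..l. q j)"
    by (rule sum.reindex_bij_witness[of _ Suc "\<lambda>j. j - 1"]) auto
  also have "\<dots> = (\<Sum>j\<le>l. q j) - 1"
    by (simp add: atMost_atLeast0 sum.atLeast_Suc_atMost q_def)
  finally have "coef s = 2 ^ Suc i + (2 ^ Suc i - 1) * ((\<Sum>j\<le>l. q j) - 1 + q l)"
    using q[of "Suc l"] l unfolding coef_def Let_def by (simp add: s_def)
  moreover have "tail_coef u = (\<Sum>j\<le>l. q j) + q l"
    using l by (simp add: tail_coef_def q_def lessThan_Suc_atMost butlast_conv_take)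
  ultimately show ?thesis
    by (simp add: s_def algebra_simps)
qed

lemma coef_pos:
  assumes "u \<noteq> []"
  shows "0 < coef ((i + 2) # map Suc u)"
proof -
  have "(1::real) \<le> 2 ^ Suc i"
    by (rule one_le_power) simp
  then have "0 \<le> (2 ^ Suc i - 1) * tail_coef u"
    by (intro mult_nonneg_nonneg tail_coef_nonneg) simp
  then show ?thesis
    unfolding coef_eq_tail_coef[OF assms] by linarith
qed

lemma has_sum_tail_coef_truncated_mzv:
  assumes x: "0 \<le> x" "x < 1/2"
  shows "((\<lambda>u. tail_coef u * x ^ sum_list u * truncated_mzv (map Suc u) N) has_sum
            (real N - 2 * x) * shuffle_sum l x N) {u. length u = Suc l}"
proof (induction l arbitrary: N)
  case 0
  have "x < 1"
    using x by simp
  have "((\<lambda>u. 2 * (x ^ sum_list u * truncated_mzv (map Suc u) N)) has_sum 2 * esum (Suc 0) x N)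
      {u. length u = Suc 0}"
    using x by (intro has_sum_cmult_right has_sum_power_truncated_mzv) auto
  also have "?this \<longleftrightarrow> ?case"
    using x unfolding shuffle_sum_0[OF \<open>x < 1\<close>] One_nat_def
    by (intro has_sum_cong) (auto simp: length_Suc_conv tail_coef_singleton)
  finally show ?case .
next
  case (Suc l)
  let ?unweighted = "\<lambda>u. x ^ hd u * x ^ sum_list (tl u)"
  let ?weighted = "\<lambda>u. (2 * x) ^ hd u * (tail_coef (tl u) * x ^ sum_list (tl u))"
  have "((\<lambda>u. ?unweighted u * truncated_mzv (map Suc u) N
        + ?weighted u * truncated_mzv (map Suc u) N) has_sum
      (\<Sum>m\<in>{1..<N}. esum (Suc l) x m / (real m - x))
        + (\<Sum>m\<in>{1..<N}. (real m - 2 * x) * shuffle_sum l x m / (real m - 2 * x)))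
      {u. length u = Suc (Suc l)}"
    using x tail_coef_nonneg
    by (intro has_sum_add has_sum_truncated_mzv_Cons Suc.IH has_sum_power_truncated_mzv) auto
  also have "(\<Sum>m\<in>{1..<N}. (real m - 2 * x) * shuffle_sum l x m / (real m - 2 * x)) =
      (\<Sum>m\<in>{1..<N}. shuffle_sum l x m)"
    using x by (intro sum.cong) auto
  also have "(\<Sum>m\<in>{1..<N}. esum (Suc l) x m / (real m - x)) + (\<Sum>m\<in>{1..<N}. shuffle_sum l x m) =
      (real N - 2 * x) * shuffle_sum (Suc l) x N"
    using x by (simp add: shuffle_sum_Suc)
  finally show ?case
  proof (rule has_sum_cong[THEN iffD1, rotated])
    fix u :: "nat list" assume "u \<in> {u. length u = Suc (Suc l)}"
    then obtain i v where "u = i # v" "v \<noteq> []"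
      by (auto simp: length_Suc_conv)
    then have "?unweighted u + ?weighted u = tail_coef u * x ^ sum_list u"
      by (simp add: tail_coef_Cons power_add power_mult_distrib algebra_simps)
    then show "?unweighted u * truncated_mzv (map Suc u) N + ?weighted u * truncated_mzv (map Suc u) N =
        tail_coef u * x ^ sum_list u * truncated_mzv (map Suc u) N"
      by (simp only: distrib_right[symmetric])
  qed
qed

lemma has_sum_double_minus_single_geometric:
  fixes m x :: real
  assumes "0 \<le> x" "2 * x < m"
  shows "((\<lambda>i. (2 ^ Suc i - 1) * x ^ i / m ^ (i + 2)) has_sum 1 / ((m - x) * (m - 2 * x))) UNIV"
proof -
  have m: "x < m" "0 < m"
    using assms by auto
  have "((\<lambda>i. 2 / m * ((2 * x) ^ i / m ^ Suc i) + - 1 / m * (x ^ i / m ^ Suc i)) has_sum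
      2 / m * (1 / (m - 2 * x)) + - 1 / m * (1 / (m - x))) UNIV"
    using assms m by (intro has_sum_add has_sum_cmult_right has_sum_geometric_shifted) auto
  moreover have "2 / m * ((2 * x) ^ i / m ^ Suc i) + - 1 / m * (x ^ i / m ^ Suc i) =
      (2 ^ Suc i - 1) * x ^ i / m ^ (i + 2)" for i
    by (simp add: power_mult_distrib left_diff_distrib diff_divide_distrib)
  moreover have "2 / m * (1 / (m - 2 * x)) + - 1 / m * (1 / (m - x)) = 1 / ((m - x) * (m - 2 * x))"
  proof -
    have "2 / (m - 2 * x) - 1 / (m - x) = m / ((m - x) * (m - 2 * x))"
      using assms m by (simp add: diff_frac_eq mult.commute)
    then have "(2 / (m - 2 * x) - 1 / (m - x)) / m = 1 / ((m - x) * (m - 2 * x))"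
      using m by simp
    then show ?thesis
      by (simp add: diff_divide_distrib mult.commute)
  qed
  ultimately show ?thesis
    by simp
qed

lemma coef_term_split:
  fixes m t x :: real
  assumes "u \<noteq> []"
  shows "coef ((i + 2) # map Suc u) * x ^ (i + sum_list u) * (t / m ^ (i + 2)) =
    x ^ i / m ^ Suc i / m * (x ^ sum_list u * t)
      + (2 ^ Suc i - 1) * x ^ i / m ^ (i + 2) * (tail_coef u * x ^ sum_list u * t)"
proof -
  have "(1 + a * b) * x ^ (i + sum_list u) * (t / m ^ (i + 2)) =
      x ^ i / m ^ Suc i / m * (x ^ sum_list u * t)
        + a * x ^ i / m ^ (i + 2) * (b * x ^ sum_list u * t)" for a b
    by (simp add: power_add distrib_right distrib_left add_divide_distrib mult_ac)
  then show ?thesis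
    by (simp only: coef_eq_tail_coef[OF assms])
qed

definition coef_generating_term :: "nat \<Rightarrow> real \<Rightarrow> nat \<Rightarrow> real" where
  "coef_generating_term l x N =
     esum (Suc l) x N / (real N * (real N - x)) + shuffle_sum l x N / (real N - x)"

lemma has_sum_coef_truncated_mzv:
  assumes x: "0 \<le> x" "x < 1/2" and "1 \<le> N"
  shows "((\<lambda>(i, u). coef ((i + 2) # map Suc u) * x ^ (i + sum_list u) *
              (truncated_mzv (map Suc u) N / real N ^ (i + 2))) has_sum coef_generating_term l x N)
           (UNIV \<times> {u. length u = Suc l})"
proof -
  have N: "x < real N" "2 * x < real N" "0 < real N"
    using x \<open>1 \<le> N\<close> by auto
  let ?index = "UNIV \<times> {u::nat list. length u = Suc l}"
  let ?unweighted = "\<lambda>i u. x ^ i / real N ^ Suc i / real N *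
    (x ^ sum_list u * truncated_mzv (map Suc u) N)"
  let ?weighted = "\<lambda>i u. (2 ^ Suc i - 1) * x ^ i / real N ^ (i + 2) *
    (tail_coef u * x ^ sum_list u * truncated_mzv (map Suc u) N)"
  have "((\<lambda>(i, u). ?unweighted i u) has_sum 1 / (real N - x) / real N * esum (Suc l) x N) ?index"
    using x N by (intro nonneg_has_sum_mult_Times has_sum_divide_const has_sum_geometric_shifted
        has_sum_power_truncated_mzv mult_nonneg_nonneg truncated_mzv_nonneg) auto
  moreover have "((\<lambda>(i, u). ?weighted i u) has_sum
      1 / ((real N - x) * (real N - 2 * x)) * ((real N - 2 * x) * shuffle_sum l x N)) ?index"
    using x N by (intro nonneg_has_sum_mult_Times has_sum_double_minus_single_geometric
        has_sum_tail_coef_truncated_mzv mult_nonneg_nonneg divide_nonneg_nonneg truncated_mzv_nonneg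
        tail_coef_nonneg) (auto simp del: power_Suc)
  ultimately have "((\<lambda>(i, u). ?unweighted i u + ?weighted i u) has_sum
      1 / (real N - x) / real N * esum (Suc l) x N
        + 1 / ((real N - x) * (real N - 2 * x)) * ((real N - 2 * x) * shuffle_sum l x N)) ?index"
    unfolding case_prod_unfold by (rule has_sum_add)
  also have "1 / (real N - x) / real N * esum (Suc l) x N
        + 1 / ((real N - x) * (real N - 2 * x)) * ((real N - 2 * x) * shuffle_sum l x N) =
      coef_generating_term l x N"
    using N by (simp add: coef_generating_term_def mult.commute del: nested_sum.simps)
  finally show ?thesis
  proof (rule has_sum_cong[THEN iffD1, rotated])
    fix iu :: "nat \<times> nat list" assume "iu \<in> ?index"
    then obtain i u where iu: "iu = (i, u)" and "u \<noteq> []"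
      by fastforce
    show "(case iu of (i, u) \<Rightarrow> ?unweighted i u + ?weighted i u) =
      (case iu of (i, u) \<Rightarrow> coef ((i + 2) # map Suc u) * x ^ (i + sum_list u) *
        (truncated_mzv (map Suc u) N / real N ^ (i + 2)))"
      unfolding iu prod.case by (rule coef_term_split[OF \<open>u \<noteq> []\<close>, symmetric])
  qed
qed

definition admissible :: "nat \<Rightarrow> nat \<Rightarrow> nat list set" where
  "admissible k n = {s. length s = k \<and> (\<forall>x\<in>set s. x \<ge> 1) \<and> s ! 0 \<ge> 2 \<and> sum_list s = n}"

lemma finite_admissible: "finite (admissible k n)"
proof (rule finite_subset)
  show "admissible k n \<subseteq> {s. set s \<subseteq> {..n} \<and> length s = k}"
    by (auto simp: admissible_def dest: member_le_sum_list)
qed (intro finite_lists_length_eq finite_atMost)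

lemma has_sum_admissible:
  "((\<lambda>(i, u). f ((i + 2) # map Suc u) * x ^ (i + sum_list u)) has_sum S) (UNIV \<times> {u. length u = l}) \<longleftrightarrow>
   ((\<lambda>(p, s). f s * x ^ p) has_sum S) (Sigma UNIV (\<lambda>p. admissible (Suc l) (l + 2 + p)))"
proof (rule has_sum_reindex_bij_witness[of _ "\<lambda>(p, s). (hd s - 2, map (\<lambda>a. a - 1) (tl s))"
      "\<lambda>(i, u). (i + sum_list u, (i + 2) # map Suc u)"])
  fix q assume "q \<in> Sigma UNIV (\<lambda>p. admissible (Suc l) (l + 2 + p))"
  then obtain p a t where q: "q = (p, a # t)" and "2 \<le> a" "length t = l" "\<forall>b\<in>set t. 1 \<le> b"
    and weight: "a + sum_list t = l + 2 + p"
    by (auto simp: admissible_def length_Suc_conv)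
  have t: "map (Suc \<circ> (\<lambda>b. b - 1)) t = t"
    using \<open>\<forall>b\<in>set t. 1 \<le> b\<close> by (intro map_idI) auto
  moreover have "sum_list t = sum_list (map (\<lambda>b. b - 1) t) + length t"
    using sum_list_Suc[of "\<lambda>b. b - 1" t] t by (simp add: comp_def)
  ultimately show "(case case q of (p, s) \<Rightarrow> (hd s - 2, map (\<lambda>a. a - 1) (tl s)) of
      (i, u) \<Rightarrow> (i + sum_list u, (i + 2) # map Suc u)) = q"
    using q \<open>2 \<le> a\<close> \<open>length t = l\<close> weight by simp
  show "(case q of (p, s) \<Rightarrow> (hd s - 2, map (\<lambda>a. a - 1) (tl s))) \<in> UNIV \<times> {u. length u = l}"
    using q \<open>length t = l\<close> by simp
qed (auto simp: admissible_def sum_list_Suc comp_def)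

lemma has_sum_coef_mzv_powser:
  assumes x: "0 < x" "x < 1/2"
    and sum: "(coef_generating_term l x has_sum S) {1..}"
  shows "((\<lambda>p. (\<Sum>s\<in>admissible (l + 2) (l + 3 + p). coef s * mzv s) * x ^ p) has_sum S) UNIV"
proof -
  let ?weight = "\<lambda>(i, u). coef ((i + 2) # map Suc u) * x ^ (i + sum_list u)"
  let ?index = "UNIV \<times> {u. length u = Suc l}"
  have "((\<lambda>iu. ?weight iu * mzv ((fst iu + 2) # map Suc (snd iu))) has_sum S) ?index"
  proof (rule nonneg_has_sum_mzv_Cons[OF _ _ sum])
    show "0 < ?weight iu" if "iu \<in> ?index" for iu
      using that x by (auto intro!: mult_pos_pos coef_pos simp del: add_2_eq_Suc')
    show "((\<lambda>iu. ?weight iu * (truncated_mzv (map Suc (snd iu)) N / real N ^ (fst iu + 2))) has_sum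
        coef_generating_term l x N) ?index" if "1 \<le> N" for N
      using has_sum_coef_truncated_mzv[OF _ _ that, of x l] x by (simp add: case_prod_unfold)
  qed
  then have "((\<lambda>(p, s). coef s * mzv s * x ^ p) has_sum S)
      (Sigma UNIV (\<lambda>p. admissible (Suc (Suc l)) (Suc l + 2 + p)))"
    by (subst has_sum_admissible[symmetric]) (simp add: case_prod_unfold mult_ac)
  then have "((\<lambda>p. \<Sum>s\<in>admissible (Suc (Suc l)) (Suc l + 2 + p). coef s * mzv s * x ^ p) has_sum S) UNIV"
    by (rule has_sum_SigmaD) (simp add: has_sum_finite_iff finite_admissible)
  then show ?thesis
    by (simp add: sum_distrib_right numeral_3_eq_3)
qed

definition zeta_generating_term :: "nat \<Rightarrow> real \<Rightarrow> nat \<Rightarrow> real" where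
  "zeta_generating_term k x m =
     real (Suc k) / (real m ^ Suc k * (real m - x)) + 1 / (real m ^ k * (real m - x)\<^sup>2)"

lemma has_sum_zeta_powser:
  assumes x: "0 < x" "x < 1"
    and sum: "(zeta_generating_term k x has_sum S) {1..}"
  shows "((\<lambda>p. real (k + 2 + p) * mzv [k + 2 + p] * x ^ p) has_sum S) UNIV"
proof -
  have "((\<lambda>p. real (k + 2 + p) * x ^ p * mzv ((k + 2 + p) # [])) has_sum S) UNIV"
  proof (rule nonneg_has_sum_mzv_Cons[OF _ _ sum])
    fix m :: nat assume "1 \<le> m"
    then have "((\<lambda>p. real (Suc k) * (x ^ p / real m ^ Suc p) / real m ^ Suc k
          + real (Suc p) * x ^ p / real m ^ (p + 2) / real m ^ k) has_sum
        real (Suc k) * (1 / (real m - x)) / real m ^ Suc k + 1 / (real m - x)\<^sup>2 / real m ^ k) UNIV"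
      using x by (intro has_sum_add has_sum_divide_const has_sum_cmult_right has_sum_geometric_shifted
          has_sum_geometric_deriv_shifted) auto
    moreover have "real (Suc k) * (x ^ p / real m ^ Suc p) / real m ^ Suc k
          + real (Suc p) * x ^ p / real m ^ (p + 2) / real m ^ k =
        real (k + 2 + p) * x ^ p * (truncated_mzv [] m / real m ^ (k + 2 + p))" for p
      by (simp add: power_add add_divide_distrib distrib_right distrib_left mult_ac)
    ultimately show "((\<lambda>p. real (k + 2 + p) * x ^ p * (truncated_mzv [] m / real m ^ (k + 2 + p)))
        has_sum zeta_generating_term k x m) UNIV"
      by (simp add: zeta_generating_term_def mult_ac)
  qed (use x in auto)
  then show ?thesis
    by (simp add: mult_ac)
qed

lemma generating_terms_have_equal_sums:
  assumes x: "0 \<le> x" "x < 1"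
  obtains S where "(coef_generating_term l x has_sum S) {1..}"
    and "(zeta_generating_term (Suc l) x has_sum S) {1..}"
proof -
  obtain A where A: "((\<lambda>m. 1 / (real m ^ (l + 2) * (real m - x))) has_sum A) {1..}"
    using summable_on_inverse_shifted_powers[OF x, of "l + 2" 1] by (auto simp: summable_on_def)
  obtain B where B: "((\<lambda>m. 1 / (real m ^ Suc l * (real m - x)\<^sup>2)) has_sum B) {1..}"
    using summable_on_inverse_shifted_powers[OF x, of "Suc l" 2] by (auto simp: summable_on_def)
  have combined: "((\<lambda>m. real j / (real m ^ (l + 2) * (real m - x))
      + 1 / (real m ^ Suc l * (real m - x)\<^sup>2)) has_sum
      real j * A + B) {1..}" for j
    using has_sum_add[OF has_sum_cmult_right[OF A, of "real j"] B] by simp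
  show thesis
  proof
    show "(coef_generating_term l x has_sum A + (real (Suc l) * A + B)) {1..}"
      unfolding coef_generating_term_def using A
      by (intro has_sum_add sum_formula has_sum_shuffle_sum sum_formula_esum_1 combined x) simp
    have "zeta_generating_term (Suc l) x =
        (\<lambda>m. real (l + 2) / (real m ^ (l + 2) * (real m - x)) + 1 / (real m ^ Suc l * (real m - x)\<^sup>2))"
      by (simp add: fun_eq_iff zeta_generating_term_def)
    moreover have "A + (real (Suc l) * A + B) = real (l + 2) * A + B"
      by (simp add: algebra_simps)
    ultimately show "(zeta_generating_term (Suc l) x has_sum A + (real (Suc l) * A + B)) {1..}"
      using combined[of "l + 2"] by (simp only:)
  qed
qed

theorem theorem1p1:
  fixes k n :: nat
  assumes "k \<ge> 2" and "n \<ge> k + 1"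
  shows "(\<Sum>s\<in>{s. length s = k \<and> (\<forall>x\<in>set s. x \<ge> 1) \<and> s ! 0 \<ge> 2 \<and> sum_list s = n}.
            coef s * mzv s) = real n * mzv [n]"
proof -
  obtain l where k: "k = l + 2"
    using assms(1) by (metis add.commute le_Suc_ex)
  obtain p where n: "n = l + 3 + p"
    using assms(2) le_Suc_ex unfolding k by fastforce
  define lhs where "lhs p = (\<Sum>s\<in>admissible (l + 2) (l + 3 + p). coef s * mzv s)" for p
  define rhs where "rhs p = real (l + 3 + p) * mzv [l + 3 + p]" for p
  have "lhs p = rhs p"
  proof (rule powser_coeffs_eq_right)
    fix x :: real assume x: "0 < x" "x < 1/2"
    then obtain S where "(coef_generating_term l x has_sum S) {1..}"
      and "(zeta_generating_term (Suc l) x has_sum S) {1..}"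
      using generating_terms_have_equal_sums[of x l] by auto
    then have "((\<lambda>p. lhs p * x ^ p) has_sum S) UNIV" "((\<lambda>p. rhs p * x ^ p) has_sum S) UNIV"
      using has_sum_coef_mzv_powser[of x l S] has_sum_zeta_powser[of x "Suc l" S] x
      by (simp_all add: lhs_def rhs_def numeral_3_eq_3)
    then show "\<exists>S. (\<lambda>p. lhs p * x ^ p) sums S \<and> (\<lambda>p. rhs p * x ^ p) sums S"
      using has_sum_imp_sums by blast
  qed simp
  then show ?thesis
    by (simp only: admissible_def lhs_def rhs_def k n)
qed

end
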